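(* Let $I$ be a solvable search instance in which all edges have cost one and $h$ is consistent, zero at goals and strictly positive at non-goals. Suppose that $h$ is perfect on $B_1$, i.e. $h(v)=h^*(v)$ for every $v\in B_1$. If $I$ is nonpathological, every strategy expands exactly $S_<$. If $I$ is pathological, then for every final tie-breaker $\sigma$ and every random outcome there exists $p\in B_1$ such that $$E_{[-h,\sigma]}=S_<\cup(S_=\setminus B_1)\cup\{p\}.$$ Consequently, $$X_{[-h,\sigma]}=\begin{cases}|S_<|,&\text{if the instance is nonpathological},\\ |S_<|+|S_=\setminus B_1|+1,&\text{otherwise.}\end{cases}$$ Every high-$h$ strategy maximizes the total expansion count among all tie-breakers. Moreover, for every strategy $\tau$ (and all random outcomes), $$E_\tau\setminus B_1\subseteq E_{[-h,\sigma]},\qquad |E_\tau\cap B_1|=|E_{[-h,\sigma]}\cap B_1|\in\{0,1\}.$$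
   Context: **Search instances.** A search instance is $I=(V,A,c,s,\mathcal G,h)$ with $(V,A)$ a finite directed graph, $c:A\to\mathbb R_{\ge0}$ edge costs, $s\notin\mathcal G$ the initial state, $\mathcal G\subseteq V$ the goals, $h:V\to\mathbb R$ a heuristic, together with a fixed order in which successors of each state are generated. $g^*(v)$ is the least cost of a path from $s$ to $v$, $h^*(v)$ the least cost of a path from $v$ to a goal ($+\infty$ if none). The instance is solvable if $C^*:=h^*(s)<\infty$. $h$ is consistent if $h(u)\le c(u,v)+h(v)$ for all $(u,v)\in A$. **A\* model.** Initially OPEN contains only $s$ with $g(s)=0$, and CLOSED is empty. Each OPEN entry stores its best known $g$-value, parent, first-insertion timestamp and goal status. At a selection point let $\mathrm{OPEN}_{\min}$ be the set of $v\in\mathrm{OPEN}$ minimizing $f(v)=g(v)+h(v)$. If $\mathrm{OPEN}_{\min}$ contains a goal, a goal is selected and the search terminates (goal preference; selecting a goal is not an expansion). Otherwise the tie-breaker selects a non-goal in $\mathrm{OPEN}_{\min}$, which is expanded: it is moved from OPEN to CLOSED and all its successors are generated in the given order. A newly encountered state is inserted into OPEN; a strictly smaller tentative $g$ updates an existing OPEN entry's $g$ and parent but keeps its first-insertion timestamp; equal- and higher-cost duplicates are discarded. (With consistent $h$ an expanded state has $g=g^*$ and is never reopened.) **Tie-breakers, sets, counts.** A tie-breaker (strategy) is an arbitrary, possibly randomized, history- and instance-dependent rule for choosing the non-goal of $\mathrm{OPEN}_{\min}$ to expand. A high-$h$ strategy $[-h,\sigma]$ always chooses among the states of $\mathrm{OPEN}_{\min}$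 of maximum $h$, using the arbitrary rule $\sigma$ for the remaining ties. $E_\tau$ is the set of non-goal states expanded by $\tau$ on $I$ and $X_\tau=|E_\tau|$ (for a given random outcome). **Layers.** With $f^*(v)=g^*(v)+h(v)$, $S_<$ and $S_=$ are the sets of reachable non-goal states with $f^*(v)<C^*$ and $f^*(v)=C^*$, respectively. $B_1=\{v\in S_=:h(v)=1\}$. **Pathology.** The instance is nonpathological (with respect to $h$) if it has an optimal solution path (path of cost $C^*$ from $s$ to a goal) with $h(v)<h^*(v)$ at every non-goal state $v$ on the path; otherwise it is pathological. *)

theory Defs
  imports "Graph_Theory.Graph_Theory"
begin

text \<open>Arcs are vertex pairs. \<open>succs I v\<close> lists the successors of \<open>v\<close> in generation order;
  the values of \<open>cost\<close>, \<open>heur\<close> and \<open>succs\<close> outside the graph are irrelevant.\<close>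

record 'a search_instance =
  graph :: "'a pair_pre_digraph"
  cost  :: "'a \<times> 'a \<Rightarrow> real"
  start :: 'a
  goals :: "'a set"
  heur  :: "'a \<Rightarrow> real"
  succs :: "'a \<Rightarrow> 'a list"

definition search_instance :: "'a search_instance \<Rightarrow> bool" where
  "search_instance I \<longleftrightarrow>
     pair_fin_digraph (graph I) \<and>
     (\<forall>e\<in>parcs (graph I). 0 \<le> cost I e) \<and>
     start I \<in> pverts (graph I) \<and>
     goals I \<subseteq> pverts (graph I) \<and>
     start I \<notin> goals I \<and>
     (\<forall>v\<in>pverts (graph I). distinct (succs I v) \<and> set (succs I v) = {w. (v, w) \<in> parcs (graph I)})"

definition gstar :: "'a search_instance \<Rightarrow> 'a \<Rightarrow> ereal" where
  "gstar I v = wf_digraph.\<mu> (with_proj (graph I)) (cost I) (start I) v"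

definition hstar :: "'a search_instance \<Rightarrow> 'a \<Rightarrow> ereal" where
  "hstar I v = (INF t\<in>goals I. wf_digraph.\<mu> (with_proj (graph I)) (cost I) v t)"

definition fstar :: "'a search_instance \<Rightarrow> 'a \<Rightarrow> ereal" where
  "fstar I v = gstar I v + ereal (heur I v)"

definition Cstar :: "'a search_instance \<Rightarrow> ereal" where
  "Cstar I = hstar I (start I)"

definition solvable :: "'a search_instance \<Rightarrow> bool" where
  "solvable I \<longleftrightarrow> Cstar I < \<infinity>"

definition consistent :: "'a search_instance \<Rightarrow> bool" where
  "consistent I \<longleftrightarrow> (\<forall>(u, v)\<in>parcs (graph I). heur I u \<le> cost I (u, v) + heur I v)"

definition reachable_nongoals :: "'a search_instance \<Rightarrow> 'a set" where
  "reachable_nongoals I = {v. reachable (with_proj (graph I)) (start I) v} - goals I"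

definition S_less :: "'a search_instance \<Rightarrow> 'a set" where
  "S_less I = {v \<in> reachable_nongoals I. fstar I v < Cstar I}"

definition S_eq :: "'a search_instance \<Rightarrow> 'a set" where
  "S_eq I = {v \<in> reachable_nongoals I. fstar I v = Cstar I}"

definition B1 :: "'a search_instance \<Rightarrow> 'a set" where
  "B1 I = {v \<in> S_eq I. heur I v = 1}"

definition optimal_solution :: "'a search_instance \<Rightarrow> ('a \<times> 'a) awalk \<Rightarrow> bool" where
  "optimal_solution I p \<longleftrightarrow>
     (\<exists>t\<in>goals I. pre_digraph.awalk (with_proj (graph I)) (start I) p t) \<and>
     ereal (wf_digraph.awalk_cost (cost I) p) = Cstar I"

definition nonpathological :: "'a search_instance \<Rightarrow> bool" where
  "nonpathological I \<longleftrightarrow>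
     (\<exists>p. optimal_solution I p \<and>
       (\<forall>v\<in>set (pre_digraph.awalk_verts (with_proj (graph I)) (start I) p) - goals I.
          ereal (heur I v) < hstar I v))"


record 'a entry =
  gval :: real
  parent :: "'a option"
  stamp :: nat
  is_goal :: bool

text \<open>\<open>clock\<close> counts the insertions made so far and supplies the next timestamp.\<close>

record 'a search_state =
  open_list :: "'a \<Rightarrow> 'a entry option"
  closed_list :: "'a \<Rightarrow> 'a entry option"
  clock :: nat

definition initial :: "'a search_instance \<Rightarrow> 'a search_state" where
  "initial I =
     \<lparr> open_list = [start I \<mapsto> \<lparr> gval = 0, parent = None, stamp = 0, is_goal = (start I \<in> goals I) \<rparr>],
       closed_list = Map.empty, clock = 1 \<rparr>"

definition fval :: "'a search_instance \<Rightarrow> 'a search_state \<Rightarrow> 'a \<Rightarrow> real" where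
  "fval I S v = gval (the (open_list S v)) + heur I v"

definition open_min :: "'a search_instance \<Rightarrow> 'a search_state \<Rightarrow> 'a set" where
  "open_min I S = {v. is_arg_min (fval I S) (\<lambda>w. w \<in> dom (open_list S)) v}"

definition candidates :: "'a search_instance \<Rightarrow> 'a search_state \<Rightarrow> 'a set" where
  "candidates I S = open_min I S - goals I"

text \<open>The search stops when OPEN is exhausted or a goal can be selected.\<close>

definition running :: "'a search_instance \<Rightarrow> 'a search_state \<Rightarrow> bool" where
  "running I S \<longleftrightarrow> dom (open_list S) \<noteq> {} \<and> open_min I S \<inter> goals I = {}"

text \<open>Generation of \<open>v\<close> as a successor of \<open>u\<close>, whose \<open>g\<close>-value is \<open>gu\<close>. A strictly cheaper path
  to a state in CLOSED reopens it with its old timestamp, as in textbook A*; under a consistent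
  heuristic this branch is never taken.\<close>

definition generate ::
    "'a search_instance \<Rightarrow> 'a \<Rightarrow> real \<Rightarrow> 'a \<Rightarrow> 'a search_state \<Rightarrow> 'a search_state" where
  "generate I u gu v S =
     (let g = gu + cost I (u, v) in
      case open_list S v of
        Some e \<Rightarrow>
          if g < gval e
          then S\<lparr> open_list := (open_list S)(v \<mapsto> e\<lparr> gval := g, parent := Some u \<rparr>) \<rparr>
          else S
      | None \<Rightarrow>
          (case closed_list S v of
             Some e \<Rightarrow>
               if g < gval e
               then S\<lparr> open_list := (open_list S)(v \<mapsto> e\<lparr> gval := g, parent := Some u \<rparr>),
                       closed_list := (closed_list S)(v := None) \<rparr>
               else S
           | None \<Rightarrow>
               S\<lparr> open_list := (open_list S)(v \<mapsto>
                     \<lparr> gval = g, parent = Some u, stamp = clock S, is_goal = (v \<in> goals I) \<rparr>),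
                  clock := Suc (clock S) \<rparr>))"

definition expand :: "'a search_instance \<Rightarrow> 'a \<Rightarrow> 'a search_state \<Rightarrow> 'a search_state" where
  "expand I u S =
     fold (generate I u (gval (the (open_list S u)))) (succs I u)
       (S\<lparr> open_list := (open_list S)(u := None),
           closed_list := (closed_list S)(u := open_list S u) \<rparr>)"

text \<open>A tie-breaking rule chooses from a set of tied states, given a random outcome of type \<open>'r\<close>, the
  instance, and the list of all search states so far, latest first. Fixing the outcome fixes
  all choices, so claims about all outcomes need no probability measure on \<open>'r\<close>.\<close>

type_synonym ('r, 'a) rule =
  "'r \<Rightarrow> 'a search_instance \<Rightarrow> 'a search_state list \<Rightarrow> 'a set \<Rightarrow> 'a"

definition tie_breaker :: "('r, 'a) rule \<Rightarrow> bool" where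
  "tie_breaker \<tau> \<longleftrightarrow> (\<forall>\<omega> I H C. finite C \<longrightarrow> C \<noteq> {} \<longrightarrow> \<tau> \<omega> I H C \<in> C)"

definition high_h :: "('r, 'a) rule \<Rightarrow> ('r, 'a) rule" where
  "high_h \<sigma> = (\<lambda>\<omega> I H C. \<sigma> \<omega> I H {v. is_arg_max (heur I) (\<lambda>w. w \<in> C) v})"

primrec history ::
    "'a search_instance \<Rightarrow> ('r, 'a) rule \<Rightarrow> 'r \<Rightarrow> nat \<Rightarrow> 'a search_state list" where
  "history I \<tau> \<omega> 0 = [initial I]"
| "history I \<tau> \<omega> (Suc n) =
     (let H = history I \<tau> \<omega> n; S = hd H in
      if running I S then expand I (\<tau> \<omega> I H (candidates I S)) S # H else H)"

definition expanded :: "'a search_instance \<Rightarrow> ('r, 'a) rule \<Rightarrow> 'r \<Rightarrow> 'a set" where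
  "expanded I \<tau> \<omega> =
     {\<tau> \<omega> I H (candidates I (hd H)) | H n. H = history I \<tau> \<omega> n \<and> running I (hd H)}"

definition expansion_count :: "'a search_instance \<Rightarrow> ('r, 'a) rule \<Rightarrow> 'r \<Rightarrow> nat" where
  "expansion_count I \<tau> \<omega> = card (expanded I \<tau> \<omega>)"

lemma tie_breaker_high_h:
  assumes "tie_breaker \<sigma>"
  shows "tie_breaker (high_h \<sigma>)"
  unfolding tie_breaker_def
proof (intro allI impI)
  fix \<omega> and I :: "'b search_instance" and H and C :: "'b set"
  assume C: "finite C" "C \<noteq> {}"
  let ?M = "{v. is_arg_max (heur I) (\<lambda>w. w \<in> C) v}"
  have sub: "?M \<subseteq> C"
    by (auto simp: is_arg_max_def)
  have "Max (heur I ` C) \<in> heur I ` C"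
    using C by simp
  then obtain v where v: "v \<in> C" "heur I v = Max (heur I ` C)"
    by auto
  then have "v \<in> ?M"
    using C by (auto simp: is_arg_max_def not_less)
  then have "\<sigma> \<omega> I H ?M \<in> ?M"
    using assms sub C(1) finite_subset unfolding tie_breaker_def by blast
  then show "high_h \<sigma> \<omega> I H C \<in> C"
    using sub unfolding high_h_def by auto
qed

end

theory Submission
  imports Defs
begin

text \<open>
  A* expands states in order of \<open>f\<close>, so \<open>S\<^sub><\<close> is exhausted before any state with \<open>f = C\<^sup>*\<close> is
  touched. With unit costs, an optimal path on which \<open>f\<close> stays constant lowers \<open>h\<close> by exactly one
  per step; hence a shortest path to a state of \<open>S\<^sub>= - B\<^sub>1\<close> runs through \<open>S\<^sub><\<close> and through states of
  \<open>S\<^sub>=\<close> with \<open>h \<ge> 2\<close>, and the high-\<open>h\<close> rule exhausts all of these before it turns to \<open>B\<^sub>1\<close>. Expanding a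
  state of \<open>B\<^sub>1\<close> puts a goal with \<open>f = C\<^sup>*\<close> on OPEN, which ends the search, and in the pathological
  case the last state before the selected goal must lie in \<open>B\<^sub>1\<close>. The instance is nonpathological
  exactly if some state of \<open>S\<^sub><\<close> is followed by a goal at distance \<open>C\<^sup>*\<close>; then this goal is on OPEN as
  soon as \<open>S\<^sub><\<close> has been expanded.
\<close>

section \<open>Walks, costs and distances under unit costs\<close>

locale unit_cost_search =
  fixes I :: "'a search_instance"
  assumes inst: "search_instance I"
    and solv: "solvable I"
    and unit_cost: "\<forall>e\<in>parcs (graph I). cost I e = 1"
    and cons: "consistent I"
    and heur_goal: "\<forall>v\<in>goals I. heur I v = 0"
    and heur_pos: "\<forall>v\<in>pverts (graph I) - goals I. 0 < heur I v"
    and perfect: "\<forall>v\<in>B1 I. ereal (heur I v) = hstar I v"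
begin

sublocale pair_fin_digraph "graph I"
  using inst by (simp add: search_instance_def)

abbreviation reach :: "'a \<Rightarrow> bool" where
  "reach v \<equiv> reachable (with_proj (graph I)) (start I) v"

text \<open>Shortest walk length as a natural number, so that induction on it is possible.
  \<open>gstar_eq\<close> identifies it with \<open>gstar\<close> on reachable states; elsewhere the
  value of \<open>LEAST\<close> carries no information.\<close>

definition dist :: "'a \<Rightarrow> nat" where
  "dist v = (LEAST n. \<exists>p. awalk (start I) p v \<and> length p = n)"

text \<open>The optimal cost as a natural number. With unit costs it is the length of a walk
  (\<open>Cstar_walk\<close>), so the floor loses nothing.\<close>

definition C :: nat where
  "C = nat \<lfloor>real_of_ereal (Cstar I)\<rfloor>"

lemma goals_verts: "t \<in> goals I \<Longrightarrow> t \<in> pverts (graph I)"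
  and start_verts: "start I \<in> pverts (graph I)"
  and start_nongoal: "start I \<notin> goals I"
  and set_succs: "v \<in> pverts (graph I) \<Longrightarrow> set (succs I v) = {w. (v, w) \<in> parcs (graph I)}"
  using inst by (auto simp: search_instance_def)

lemma heur_arc: "(u, v) \<in> parcs (graph I) \<Longrightarrow> heur I u \<le> 1 + heur I v"
  using cons unit_cost by (auto simp: consistent_def)

lemma walk_cost: "awalk u p v \<Longrightarrow> awalk_cost (cost I) p = real (length p)"
proof (induction p arbitrary: u)
  case (Cons e p)
  then show ?case
    using unit_cost by (auto simp: awalk_Cons_iff)
qed simp

lemma \<mu>_le: "awalk u p v \<Longrightarrow> \<mu> (cost I) u v \<le> ereal (real (length p))"
  using min_cost_le_walk_cost walk_cost by metis

text \<open>\<open>\<mu>\<close> is an infimum over all walks; as costs are nonnegative, some simple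
  path attains it.\<close>

lemma \<mu>_attained:
  assumes "reachable (with_proj (graph I)) u v"
  obtains p where "awalk u p v" "\<mu> (cost I) u v = ereal (real (length p))"
proof -
  have "\<And>e. e \<in> parcs (graph I) \<Longrightarrow> 0 \<le> cost I e"
    using unit_cost by simp
  then obtain p where "apath u p v" "\<mu> (cost I) u v = awalk_cost (cost I) p"
    using min_cost_awalk[OF assms] by blast
  then show ?thesis
    using that walk_cost awalkI_apath by metis
qed

lemma dist_walk:
  assumes "reach v"
  obtains p where "awalk (start I) p v" "length p = dist v"
proof -
  obtain q where "awalk (start I) q v"
    using assms reachable_awalk by auto
  then have "\<exists>p. awalk (start I) p v \<and> length p = dist v"
    unfolding dist_def
    using LeastI[of "\<lambda>n. \<exists>p. awalk (start I) p v \<and> length p = n" "length q"] by blast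
  then show ?thesis
    using that by blast
qed

lemma dist_le: "awalk (start I) p v \<Longrightarrow> dist v \<le> length p"
  unfolding dist_def by (rule Least_le) blast

lemma gstar_eq:
  assumes "reach v"
  shows "gstar I v = ereal (real (dist v))"
proof (rule antisym)
  show "gstar I v \<le> ereal (real (dist v))"
    using dist_walk[OF assms] \<mu>_le unfolding gstar_def by metis
  obtain p where p: "awalk (start I) p v" "\<mu> (cost I) (start I) v = ereal (real (length p))"
    using \<mu>_attained[OF assms] .
  then show "ereal (real (dist v)) \<le> gstar I v"
    using dist_le[OF p(1)] by (simp add: gstar_def)
qed

lemma hstar_le: "awalk v p t \<Longrightarrow> t \<in> goals I \<Longrightarrow> hstar I v \<le> ereal (real (length p))"
  unfolding hstar_def using \<mu>_le by (meson INF_lower2)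

text \<open>Finiteness of \<open>goals I\<close> turns the infimum into a minimum. There is at least
  one goal, since the infimum over none would be \<infinity>.\<close>

lemma hstar_attained:
  assumes "hstar I v < \<infinity>"
  obtains t p where "t \<in> goals I" "awalk v p t" "hstar I v = ereal (real (length p))"
proof -
  have "goals I \<noteq> {}"
    using assms by (auto simp: hstar_def top_ereal_def)
  moreover have "finite (goals I)"
    using pair_finite_verts goals_verts by (meson finite_subset subsetI)
  ultimately have "hstar I v \<in> \<mu> (cost I) v ` goals I"
    unfolding hstar_def by (intro finite_INF_in) auto
  then obtain t where t: "t \<in> goals I" "hstar I v = \<mu> (cost I) v t"
    by auto
  then have "reachable (with_proj (graph I)) v t"
    using assms \<mu>_reach_conv by simp
  then show ?thesis
    using \<mu>_attained t that by metis
qed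

lemma Cstar_walk:
  obtains t p where "t \<in> goals I" "awalk (start I) p t" "Cstar I = ereal (real C)" "length p = C"
proof -
  have "hstar I (start I) < \<infinity>"
    using solv by (simp add: solvable_def Cstar_def)
  then obtain t p where "t \<in> goals I" "awalk (start I) p t"
      "hstar I (start I) = ereal (real (length p))"
    using hstar_attained by blast
  then show ?thesis
    by (intro that[of t p]) (auto simp: C_def Cstar_def)
qed

lemma Cstar_eq: "Cstar I = ereal (real C)"
  using Cstar_walk by blast

lemma C_le_walk: "awalk (start I) p t \<Longrightarrow> t \<in> goals I \<Longrightarrow> C \<le> length p"
  using hstar_le[of "start I" p t] Cstar_eq by (simp add: Cstar_def)

lemma C_le_dist: "reach t \<Longrightarrow> t \<in> goals I \<Longrightarrow> C \<le> dist t"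
  using dist_walk C_le_walk by metis

lemma optimal_goal:
  obtains t where "t \<in> goals I" "reach t" "dist t = C"
proof -
  obtain t p where "t \<in> goals I" "awalk (start I) p t" "length p = C"
    using Cstar_walk by blast
  moreover from this have "reach t"
    using reachable_awalk by auto
  ultimately show ?thesis
    using that dist_le C_le_dist by (metis le_antisym)
qed

lemma dist_start: "dist (start I) = 0"
  using dist_le[of "[]" "start I"] start_verts by (simp add: awalk_Nil_iff)

lemma reach_start: "reach (start I)"
  using start_verts by simp

lemma reach_verts: "reach v \<Longrightarrow> v \<in> pverts (graph I)"
  using reachable_in_verts by simp

lemma reach_arc: "reach u \<Longrightarrow> (u, v) \<in> parcs (graph I) \<Longrightarrow> reach v"
  using reachable_adj_trans by simp

lemma dist_arc:
  assumes "reach u" "(u, v) \<in> parcs (graph I)"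
  shows "dist v \<le> dist u + 1"
proof -
  obtain p where p: "awalk (start I) p u" "length p = dist u"
    using dist_walk[OF assms(1)] .
  have "awalk u [(u, v)] v"
    using arc_implies_awalk[OF assms(2)] by simp
  then show ?thesis
    using dist_le[OF awalk_appendI[OF p(1)], of "[(u, v)]" v] p(2) by simp
qed

lemma walk_snoc:
  assumes "awalk u p v" "p \<noteq> []"
  obtains q w where "p = q @ [(w, v)]" "awalk u q w" "(w, v) \<in> parcs (graph I)"
proof -
  obtain q e where p: "p = q @ [e]"
    using assms(2) by (cases p rule: rev_cases) auto
  then have "awalk u q (fst e)" "snd e = v" "e \<in> parcs (graph I)"
    using assms(1) by (auto simp: awalk_simps)
  then show ?thesis
    using that[of q "fst e"] p by auto
qed

text \<open>Deleting the last arc of a shortest walk leaves a walk to \<open>u\<close> of length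
  \<open>dist v - 1\<close>; \<open>dist_arc\<close> shows that none is shorter.\<close>

lemma dist_pred:
  assumes "reach v" "v \<noteq> start I"
  obtains u where "reach u" "(u, v) \<in> parcs (graph I)" "dist v = dist u + 1"
proof -
  obtain p where p: "awalk (start I) p v" "length p = dist v"
    using dist_walk[OF assms(1)] .
  then have "p \<noteq> []"
    using assms(2) by (auto simp: awalk_Nil_iff)
  then obtain q u where q: "p = q @ [(u, v)]" "awalk (start I) q u" "(u, v) \<in> parcs (graph I)"
    using walk_snoc p(1) by metis
  have "reach u"
    using q(2) reachable_awalk by auto
  moreover have "dist v = dist u + 1"
    using dist_le[OF q(2)] dist_arc[OF \<open>reach u\<close> q(3)] p(2) q(1) by simp
  ultimately show ?thesis
    using that q(3) by blast
qed

section \<open>The layers and a local criterion for pathology\<close>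

lemma fstar_eq: "reach v \<Longrightarrow> fstar I v = ereal (real (dist v) + heur I v)"
  by (simp add: fstar_def gstar_eq)

lemma S_less_iff: "v \<in> S_less I \<longleftrightarrow> reach v \<and> v \<notin> goals I \<and> real (dist v) + heur I v < real C"
  by (auto simp: S_less_def reachable_nongoals_def fstar_eq Cstar_eq)

lemma S_eq_iff: "v \<in> S_eq I \<longleftrightarrow> reach v \<and> v \<notin> goals I \<and> real (dist v) + heur I v = real C"
  by (auto simp: S_eq_def reachable_nongoals_def fstar_eq Cstar_eq)

lemma B1_iff: "v \<in> B1 I \<longleftrightarrow> v \<in> S_eq I \<and> heur I v = 1"
  by (auto simp: B1_def)

text \<open>On \<open>S\<^sub>=\<close> the heuristic is a positive integer, being a difference of path lengths.\<close>

lemma S_eq_heur: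
  assumes "v \<in> S_eq I - B1 I"
  shows "2 \<le> heur I v"
proof -
  have "0 < heur I v" "heur I v \<noteq> 1" "heur I v = real C - real (dist v)"
    using assms heur_pos reach_verts by (auto simp: S_eq_iff B1_iff)
  moreover from this have "heur I v = real (C - dist v)"
    by simp
  ultimately have "2 \<le> C - dist v"
    by (metis One_nat_def Suc_1 Suc_leI le_neq_implies_less of_nat_0_less_iff of_nat_1)
  then show ?thesis
    using \<open>heur I v = real (C - dist v)\<close> by simp
qed

text \<open>Perfection of the heuristic on \<open>B1\<close> enters here: \<open>hstar\<close> is 1
  at \<open>b\<close>, and a minimizing walk of length 1 is a single arc into a goal.\<close>

lemma B1_goal:
  assumes "b \<in> B1 I"
  obtains t where "t \<in> goals I" "(b, t) \<in> parcs (graph I)" "real (dist b) + 1 = real C"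
proof -
  have h: "hstar I b = 1"
    using perfect assms by (simp add: B1_iff one_ereal_def)
  then have "hstar I b < \<infinity>"
    by simp
  then obtain t p where t: "t \<in> goals I" "awalk b p t" "hstar I b = ereal (real (length p))"
    using hstar_attained by blast
  then have "length p = 1"
    using h by simp
  then obtain e where "p = [e]"
    by (metis One_nat_def length_0_conv length_Suc_conv)
  then have "(b, t) \<in> parcs (graph I)"
    using t(2) by (cases e) (auto simp: awalk_simps)
  then show ?thesis
    using that t(1) assms by (auto simp: B1_iff S_eq_iff)
qed

text \<open>Any walk from \<open>v\<close> to a goal completes \<open>p\<close> to a solution, and
  solutions have length at least \<open>C\<close>.\<close>

lemma hstar_ge:
  assumes "awalk (start I) p v"
  shows "ereal (real C - real (length p)) \<le> hstar I v"
proof (cases "hstar I v < \<infinity>")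
  case True
  then obtain t q where t: "t \<in> goals I" "awalk v q t" "hstar I v = ereal (real (length q))"
    using hstar_attained by blast
  then show ?thesis
    using C_le_walk[OF awalk_appendI[OF assms t(2)] t(1)] by simp
qed auto

lemma walk_verts_split:
  assumes "awalk u p v" "w \<in> set (pawalk_verts u p)"
  obtains q r where "p = q @ r" "awalk u q w" "awalk w r v"
  using awalk_decomp[OF assms] by blast

lemma heur_walk: "awalk u p v \<Longrightarrow> heur I u \<le> real (length p) + heur I v"
proof (induction p arbitrary: u)
  case Nil
  then show ?case by (simp add: awalk_Nil_iff)
next
  case (Cons e p)
  then have "heur I (snd e) \<le> real (length p) + heur I v" "heur I u \<le> 1 + heur I (snd e)"
    using heur_arc[of "fst e" "snd e"] by (auto simp: awalk_Cons_iff)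
  then show ?case
    by simp
qed

text \<open>From left to right, \<open>u\<close> is the last state before the goal: h(u) < h*(u)
  \<le> 1 and \<open>dist u + 1 \<le> C\<close> place it in \<open>S_less\<close>. Conversely, a
  shortest walk to \<open>u\<close> followed by the arc to \<open>t\<close> is optimal, and
  consistency carries the strict inequality from \<open>u\<close> back to all earlier
  states.\<close>

lemma nonpathological_iff:
  "nonpathological I \<longleftrightarrow>
     (\<exists>u\<in>S_less I. \<exists>t\<in>goals I. (u, t) \<in> parcs (graph I) \<and> dist t = C)"
proof
  assume "nonpathological I"
  then obtain p where opt: "optimal_solution I p"
    and h: "\<forall>v\<in>set (pawalk_verts (start I) p) - goals I. ereal (heur I v) < hstar I v"
    by (auto simp: nonpathological_def awalk_verts_with_proj_eq)
  then obtain t where t: "t \<in> goals I" "awalk (start I) p t"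
    by (auto simp: optimal_solution_def)
  have len: "length p = C"
    using opt walk_cost[OF t(2)] Cstar_eq by (simp add: optimal_solution_def)
  have "p \<noteq> []"
    using t start_nongoal by (auto simp: awalk_Nil_iff)
  then obtain q u where q: "p = q @ [(u, t)]" "awalk (start I) q u" "(u, t) \<in> parcs (graph I)"
    using walk_snoc t(2) by metis
  have "reach t" "reach u"
    using t(2) q(2) reachable_awalk by auto
  \<comment> \<open>Otherwise \<open>q\<close> would be a solution of length
    \<open>C - 1\<close>.\<close>
  have "u \<notin> goals I"
    using C_le_walk[OF q(2)] len q(1) by auto
  moreover have "u \<in> set (pawalk_verts (start I) p)"
    using awalk_verts_arc1[of "(u, t)" p "start I"] q(1) by simp
  ultimately have "ereal (heur I u) < hstar I u"
    using h by blast
  also have "hstar I u \<le> 1"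
    using hstar_le[of u "[(u, t)]" t] arc_implies_awalk[OF q(3)] t(1) by (simp add: one_ereal_def)
  finally have "heur I u < 1"
    by (simp add: one_ereal_def)
  moreover have "dist u + 1 \<le> C"
    using dist_le[OF q(2)] len q(1) by simp
  ultimately have "u \<in> S_less I"
    using \<open>reach u\<close> \<open>u \<notin> goals I\<close> by (simp add: S_less_iff)
  moreover have "dist t = C"
    using dist_le[OF t(2)] len C_le_dist[OF \<open>reach t\<close> t(1)] by simp
  ultimately show "\<exists>u\<in>S_less I. \<exists>t\<in>goals I. (u, t) \<in> parcs (graph I) \<and> dist t = C"
    using t(1) q(3) by blast
next
  assume "\<exists>u\<in>S_less I. \<exists>t\<in>goals I. (u, t) \<in> parcs (graph I) \<and> dist t = C"
  then obtain u t where u: "u \<in> S_less I" and t: "t \<in> goals I" "(u, t) \<in> parcs (graph I)" "dist t = C"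
    by blast
  then have "reach u"
    by (simp add: S_less_iff)
  then obtain p where p: "awalk (start I) p u" "length p = dist u"
    using dist_walk by blast
  have hu: "0 < heur I u"
    using u heur_pos reach_verts by (auto simp: S_less_iff)
  let ?p = "p @ [(u, t)]"
  have walk: "awalk (start I) ?p t"
    using awalk_appendI[OF p(1)] arc_implies_awalk[OF t(2)] by simp
  \<comment> \<open>Positivity of h at \<open>u\<close> gives \<open>dist u < C\<close>, and
    \<open>dist_arc\<close> gives \<open>C \<le> dist u + 1\<close>; by integrality the two
    meet.\<close>
  have "length ?p = C"
    using dist_arc[OF \<open>reach u\<close> t(2)] t(3) u hu p(2) by (auto simp: S_less_iff)
  then have "optimal_solution I ?p"
    using walk t(1) walk_cost[OF walk] Cstar_eq by (auto simp: optimal_solution_def)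
  moreover have "ereal (heur I v) < hstar I v"
    if v: "v \<in> set (pawalk_verts (start I) ?p) - goals I" for v
  proof -
    have "set (pawalk_verts (start I) ?p) \<subseteq> insert t (set (pawalk_verts (start I) p))"
      using awalk_verts_append[OF walk] by simp
    then have "v \<in> set (pawalk_verts (start I) p)"
      using v t(1) by blast
    then obtain q r where qr: "p = q @ r" "awalk (start I) q v" "awalk v r u"
      using walk_verts_split[OF p(1)] by blast
    \<comment> \<open>Consistency along \<open>r\<close> bounds h(v) by \<open>length r\<close> plus
      h(u), while the lengths of \<open>q\<close> and \<open>r\<close> add up to
      \<open>dist u\<close>.\<close>
    have "heur I v + real (length q) < real C"
      using heur_walk[OF qr(3)] qr(1) p(2) u by (simp add: S_less_iff)
    then have "ereal (heur I v) < ereal (real C - real (length q))"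
      by simp
    also have "\<dots> \<le> hstar I v"
      using hstar_ge[OF qr(2)] .
    finally show ?thesis .
  qed
  ultimately show "nonpathological I"
    unfolding nonpathological_def awalk_verts_with_proj_eq by blast
qed

section \<open>Effect of an expansion on g-values, and the search invariant\<close>

definition gopen :: "'a search_state \<Rightarrow> 'a \<Rightarrow> real option" where
  "gopen S v = map_option gval (open_list S v)"

lemma gopen_None_iff: "gopen S v = None \<longleftrightarrow> open_list S v = None"
  by (simp add: gopen_def)

lemma gopen_Some_iff: "gopen S v = Some g \<longleftrightarrow> (\<exists>e. open_list S v = Some e \<and> gval e = g)"
  by (simp add: gopen_def)

text \<open>The premise excludes the reopening branch of \<open>generate\<close>: a closed
  \<open>v\<close> is off OPEN and its g-value does not exceed the new one. Only an insertion or a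
  minimum with the old value remains.\<close>

lemma
  assumes "\<And>e. closed_list S v = Some e \<Longrightarrow> open_list S v = None \<and> gval e \<le> gu + cost I (u, v)"
  shows closed_list_generate: "closed_list (generate I u gu v S) = closed_list S"
    and gopen_generate: "gopen (generate I u gu v S) w =
      (if w = v \<and> closed_list S v = None
       then Some (case gopen S v of None \<Rightarrow> gu + cost I (u, v) | Some g \<Rightarrow> min g (gu + cost I (u, v)))
       else gopen S w)"
  using assms by (auto simp: gopen_def generate_def Let_def min_def split: option.split)

text \<open>Each generation touches only the entry of its own successor and preserves the premise,
  so induction over the list gives the combined update pointwise.\<close>

lemma
  assumes "\<And>v e. v \<in> set vs \<Longrightarrow> closed_list S v = Some e \<Longrightarrow>
      open_list S v = None \<and> gval e \<le> gu + cost I (u, v)"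
  shows closed_list_fold_generate: "closed_list (fold (generate I u gu) vs S) = closed_list S"
    and gopen_fold_generate: "gopen (fold (generate I u gu) vs S) w =
      (if w \<in> set vs \<and> closed_list S w = None
       then Some (case gopen S w of None \<Rightarrow> gu + cost I (u, w) | Some g \<Rightarrow> min g (gu + cost I (u, w)))
       else gopen S w)"
proof -
  have "closed_list (fold (generate I u gu) vs S) = closed_list S \<and>
    (\<forall>w. gopen (fold (generate I u gu) vs S) w =
      (if w \<in> set vs \<and> closed_list S w = None
       then Some (case gopen S w of None \<Rightarrow> gu + cost I (u, w) | Some g \<Rightarrow> min g (gu + cost I (u, w)))
       else gopen S w))"
    using assms
  proof (induction vs arbitrary: S)
    case (Cons v vs)
    let ?S = "generate I u gu v S"
    have v: "\<And>e. closed_list S v = Some e \<Longrightarrow> open_list S v = None \<and> gval e \<le> gu + cost I (u, v)"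
      using Cons.prems by simp
    note cl = closed_list_generate[of S v gu u, OF v] and op = gopen_generate[of S v gu u, OF v]
    have "open_list ?S w = None \<and> gval e \<le> gu + cost I (u, w)"
      if "w \<in> set vs" "closed_list ?S w = Some e" for w e
      using op[of w] cl that Cons.prems[of w e] gopen_None_iff[of ?S w] gopen_None_iff[of S w]
      by (auto split: if_splits)
    from Cons.IH[OF this] show ?case
      using cl op by (auto split: option.splits)
  qed simp
  then show "closed_list (fold (generate I u gu) vs S) = closed_list S"
    and "gopen (fold (generate I u gu) vs S) w =
      (if w \<in> set vs \<and> closed_list S w = None
       then Some (case gopen S w of None \<Rightarrow> gu + cost I (u, w) | Some g \<Rightarrow> min g (gu + cost I (u, w)))
       else gopen S w)"
    by blast+
qed

text \<open>The parent clause for OPEN serves to find the state from which a selected goal was generated.\<close>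

definition search_inv :: "'a search_state \<Rightarrow> bool" where
  "search_inv S \<longleftrightarrow>
     (\<forall>v g. gopen S v = Some g \<longrightarrow> closed_list S v = None \<and> reach v \<and>
        (v = start I \<and> g = 0 \<or>
         (\<exists>u\<in>dom (closed_list S). (u, v) \<in> parcs (graph I) \<and> g = real (dist u) + 1))) \<and>
     (\<forall>v e. closed_list S v = Some e \<longrightarrow> reach v \<and> v \<notin> goals I \<and> gval e = real (dist v)) \<and>
     (start I \<in> dom (closed_list S) \<or> gopen S (start I) = Some 0) \<and>
     (\<forall>u\<in>dom (closed_list S). \<forall>v. (u, v) \<in> parcs (graph I) \<longrightarrow>
        v \<in> dom (closed_list S) \<or> (\<exists>g. gopen S v = Some g \<and> g \<le> real (dist u) + 1))"

lemma search_inv_initial: "search_inv (initial I)"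
  using reach_start by (auto simp: search_inv_def initial_def gopen_def)

text \<open>A g-value on OPEN is 0 at the start or one more than the distance of a closed parent.
  Either way a walk of that length exists, which bounds the distance from above.\<close>

lemma inv_open:
  assumes "search_inv S" "gopen S v = Some g"
  shows "closed_list S v = None" "reach v" "real (dist v) \<le> g"
    and "v \<noteq> start I \<Longrightarrow>
      \<exists>u\<in>dom (closed_list S). (u, v) \<in> parcs (graph I) \<and> g = real (dist u) + 1"
proof -
  have *: "closed_list S v = None \<and> reach v \<and> (v = start I \<and> g = 0 \<or>
      (\<exists>u\<in>dom (closed_list S). (u, v) \<in> parcs (graph I) \<and> g = real (dist u) + 1))"
    using assms unfolding search_inv_def by blast
  then show "closed_list S v = None" "reach v"
    and "v \<noteq> start I \<Longrightarrow>
      \<exists>u\<in>dom (closed_list S). (u, v) \<in> parcs (graph I) \<and> g = real (dist u) + 1"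
    by blast+
  have "real (dist v) \<le> real (dist u) + 1"
    if "u \<in> dom (closed_list S)" "(u, v) \<in> parcs (graph I)" for u
  proof -
    have "reach u"
      using assms(1) that(1) unfolding search_inv_def by blast
    then show ?thesis
      using dist_arc[OF _ that(2)] by fastforce
  qed
  then show "real (dist v) \<le> g"
    using * dist_start by auto
qed

lemma inv_closed:
  assumes "search_inv S" "v \<in> dom (closed_list S)"
  shows "reach v" "v \<notin> goals I"
  using assms unfolding search_inv_def by blast+

lemma inv_succ:
  assumes "search_inv S" "u \<in> dom (closed_list S)" "(u, v) \<in> parcs (graph I)"
    and "v \<notin> dom (closed_list S)"
  obtains g where "gopen S v = Some g" "g \<le> real (dist u) + 1"
  using assms unfolding search_inv_def by blast

text \<open>Walk back along a shortest walk to \<open>v\<close>. If the predecessor is closed, its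
  expansion has put \<open>v\<close> on OPEN with optimal g; otherwise induct on the distance.
  Consistency keeps f from rising on the way back. The bound on \<open>dist u\<close> is what later
  yields a lower bound on h at \<open>u\<close>.\<close>

lemma frontier:
  assumes "search_inv S" "reach v" "v \<notin> dom (closed_list S)"
  obtains u where "gopen S u = Some (real (dist u))" "dist u \<le> dist v"
    "real (dist u) + heur I u \<le> real (dist v) + heur I v"
proof -
  have "\<exists>u. gopen S u = Some (real (dist u)) \<and> dist u \<le> dist v \<and>
      real (dist u) + heur I u \<le> real (dist v) + heur I v"
    using assms(2,3)
  proof (induction "dist v" arbitrary: v rule: less_induct)
    case less
    show ?case
    proof (cases "v = start I")
      case True
      then have "gopen S v = Some 0"
        using assms(1) less.prems unfolding search_inv_def by blast
      then show ?thesis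
        using True dist_start by (intro exI[of _ v]) simp
    next
      case False
      then obtain u where u: "reach u" "(u, v) \<in> parcs (graph I)" "dist v = dist u + 1"
        using dist_pred less.prems(1) by blast
      show ?thesis
      proof (cases "u \<in> dom (closed_list S)")
        case True
        then obtain g where g: "gopen S v = Some g" "g \<le> real (dist u) + 1"
          using inv_succ[OF assms(1) True u(2) less.prems(2)] by blast
        \<comment> \<open>\<open>g\<close> is at most \<open>dist u + 1 = dist v\<close> by the
          closed predecessor, and at least \<open>dist v\<close> by \<open>inv_open\<close>.\<close>
        then have "g = real (dist v)"
          using inv_open(3)[OF assms(1) g(1)] u(3) by simp
        then show ?thesis
          using g(1) by blast
      next
        case False
        then obtain w where "gopen S w = Some (real (dist w))" "dist w \<le> dist u"
          "real (dist w) + heur I w \<le> real (dist u) + heur I u"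
          using less.hyps[OF _ u(1)] u(3) by auto
        then show ?thesis
          using heur_arc[OF u(2)] u(3) by (intro exI[of _ w]) simp
      qed
    qed
  qed
  then show ?thesis
    using that by blast
qed

text \<open>When \<open>c\<close> is expanded with optimal g, no closed state is reopened, so CLOSED
  just gains \<open>c\<close> and the formula for folded generations applies.\<close>

lemma
  assumes "search_inv S" "gopen S c = Some (real (dist c))"
  shows closed_list_expand: "closed_list (expand I c S) = (closed_list S)(c := open_list S c)"
    and gopen_expand: "gopen (expand I c S) w =
      (if (c, w) \<in> parcs (graph I) \<and> w \<notin> insert c (dom (closed_list S))
       then Some (case gopen S w of None \<Rightarrow> real (dist c) + 1 | Some g \<Rightarrow> min g (real (dist c) + 1))
       else if w = c then None else gopen S w)"
proof -
  let ?S = "S\<lparr> open_list := (open_list S)(c := None),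
           closed_list := (closed_list S)(c := open_list S c) \<rparr>"
  obtain e where e: "open_list S c = Some e" "gval e = real (dist c)"
    using assms(2) by (auto simp: gopen_Some_iff)
  have "reach c"
    using inv_open(2)[OF assms] .
  then have succs: "set (succs I c) = {w. (c, w) \<in> parcs (graph I)}"
    using set_succs reach_verts by blast
  \<comment> \<open>Closed states carry their true distance, at most \<open>dist c + 1\<close> for a
    successor of \<open>c\<close>. The case \<open>v = c\<close> is a self-loop: \<open>c\<close>
    enters CLOSED before its successors are generated.\<close>
  have old: "open_list ?S v = None \<and> gval e' \<le> gval e + cost I (c, v)"
    if "v \<in> set (succs I c)" "closed_list ?S v = Some e'" for v e'
  proof (cases "v = c")
    case True
    then show ?thesis
      using that e unit_cost succs by auto
  next
    case False
    then have v: "closed_list S v = Some e'"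
      using that by simp
    then have "gval e' = real (dist v)"
      using assms(1) unfolding search_inv_def by blast
    moreover have "dist v \<le> dist c + 1"
      using dist_arc[OF \<open>reach c\<close>] that(1) succs by blast
    moreover have "open_list S v = None"
      using v inv_open(1)[OF assms(1), of v] by (cases "gopen S v") (auto simp: gopen_None_iff)
    ultimately show ?thesis
      using that(1) succs unit_cost e(2) by auto
  qed
  have ex: "expand I c S = fold (generate I c (gval e)) (succs I c) ?S"
    using e by (simp add: expand_def)
  show "closed_list (expand I c S) = (closed_list S)(c := open_list S c)"
    using closed_list_fold_generate[OF old] ex by simp
  have "gopen (expand I c S) w =
      (if w \<in> set (succs I c) \<and> closed_list ?S w = None
       then Some (case gopen ?S w of None \<Rightarrow> gval e + cost I (c, w)
         | Some g \<Rightarrow> min g (gval e + cost I (c, w)))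
       else gopen ?S w)"
    unfolding ex by (rule gopen_fold_generate[OF old])
  moreover have "gopen ?S w = (if w = c then None else gopen S w)"
    by (simp add: gopen_def)
  ultimately show "gopen (expand I c S) w =
      (if (c, w) \<in> parcs (graph I) \<and> w \<notin> insert c (dom (closed_list S))
       then Some (case gopen S w of None \<Rightarrow> real (dist c) + 1 | Some g \<Rightarrow> min g (real (dist c) + 1))
       else if w = c then None else gopen S w)"
    using succs unit_cost e by (auto simp: domIff split: option.split)
qed

lemma dom_closed_list_expand:
  assumes "search_inv S" "gopen S c = Some (real (dist c))"
  shows "dom (closed_list (expand I c S)) = insert c (dom (closed_list S))"
  using closed_list_expand[OF assms] assms(2) by (auto simp: gopen_Some_iff)

text \<open>New and lowered OPEN entries have \<open>c\<close> as closed parent; the other entries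
  keep their witnesses because CLOSED only grows. Optimality of g at \<open>c\<close> establishes
  the clause on CLOSED.\<close>

lemma search_inv_expand:
  assumes inv: "search_inv S" and c: "gopen S c = Some (real (dist c))" and ng: "c \<notin> goals I"
  shows "search_inv (expand I c S)"
proof -
  let ?S = "expand I c S"
  note op = gopen_expand[OF inv c] and dom = dom_closed_list_expand[OF inv c]
  have "reach c"
    using inv_open(2)[OF inv c] .
  have "closed_list ?S v = None \<and> reach v \<and> (v = start I \<and> g = 0 \<or>
         (\<exists>u\<in>dom (closed_list ?S). (u, v) \<in> parcs (graph I) \<and> g = real (dist u) + 1))"
    if "gopen ?S v = Some g" for v g
  \<comment> \<open>The split is on whether \<open>c\<close> can witness the parent clause for
    \<open>v\<close>; an older entry of the same value is covered by this case too.\<close>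
  proof (cases "(c, v) \<in> parcs (graph I) \<and> v \<notin> insert c (dom (closed_list S)) \<and>
      g = real (dist c) + 1")
    case True
    then have "v \<notin> dom (closed_list ?S)"
      using dom by blast
    then show ?thesis
      using True dom reach_arc[OF \<open>reach c\<close>] by blast
  next
    case False
    then have v: "v \<noteq> c" "gopen S v = Some g"
      using that op[of v] by (auto split: if_splits option.splits simp: min_def)
    then have "closed_list S v = None \<and> reach v \<and> (v = start I \<and> g = 0 \<or>
         (\<exists>u\<in>dom (closed_list S). (u, v) \<in> parcs (graph I) \<and> g = real (dist u) + 1))"
      using inv unfolding search_inv_def by blast
    moreover have "v \<notin> dom (closed_list ?S)"
      using dom v(1) inv_open(1)[OF inv v(2)] by blast
    ultimately show ?thesis
      using dom by blast
  qed
  moreover have "reach v \<and> v \<notin> goals I \<and> gval e = real (dist v)"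
    if "closed_list ?S v = Some e" for v e
  proof (cases "v = c")
    case True
    then show ?thesis
      using that c ng \<open>reach c\<close> closed_list_expand[OF inv c] by (auto simp: gopen_Some_iff)
  next
    case False
    then have "closed_list S v = Some e"
      using that closed_list_expand[OF inv c] by simp
    then show ?thesis
      using inv unfolding search_inv_def by blast
  qed
  moreover have "start I \<in> dom (closed_list ?S) \<or> gopen ?S (start I) = Some 0"
  proof (cases "start I \<in> dom (closed_list ?S)")
    case False
    then have "gopen S (start I) = Some 0" "start I \<noteq> c"
      using inv dom unfolding search_inv_def by blast+
    then show ?thesis
      using op[of "start I"] by simp
  qed blast
  moreover have "v \<in> dom (closed_list ?S) \<or> (\<exists>g. gopen ?S v = Some g \<and> g \<le> real (dist u) + 1)"
    if u: "u \<in> dom (closed_list ?S)" and arc: "(u, v) \<in> parcs (graph I)" for u v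
  proof (cases "v \<in> insert c (dom (closed_list S))")
    case False
    show ?thesis
    proof (cases "u = c")
      case True
      then show ?thesis
        using op[of v] False arc by (auto split: option.splits)
    next
      case ne: False
      then have "u \<in> dom (closed_list S)"
        using u dom by blast
      then obtain g where "gopen S v = Some g" "g \<le> real (dist u) + 1"
        using inv_succ[OF inv _ arc] False by blast
      then show ?thesis
        using op[of v] False by (auto simp: min_def)
    qed
  qed (use dom in blast)
  ultimately show ?thesis
    unfolding search_inv_def by blast
qed

section \<open>States of minimal f on OPEN\<close>

lemma open_min_iff: "v \<in> open_min I S \<longleftrightarrow>
    (\<exists>g. gopen S v = Some g \<and> (\<forall>w g'. gopen S w = Some g' \<longrightarrow> g + heur I v \<le> g' + heur I w))"
proof -
  have "gopen S w = Some g \<longleftrightarrow> w \<in> dom (open_list S) \<and> g = gval (the (open_list S w))" for w g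
    by (auto simp: gopen_Some_iff)
  then show ?thesis
    by (auto simp: open_min_def is_arg_min_def fval_def not_less simp del: domIff)
qed

lemma open_min_subset: "open_min I S \<subseteq> dom (open_list S)"
  by (auto simp: open_min_def is_arg_min_def)

lemma finite_open:
  assumes "search_inv S"
  shows "finite (dom (open_list S))"
proof (rule finite_subset[OF _ pair_finite_verts])
  show "dom (open_list S) \<subseteq> pverts (graph I)"
    using inv_open(2)[OF assms] reach_verts by (auto simp: gopen_Some_iff)
qed

lemma open_min_ne:
  assumes "search_inv S" "dom (open_list S) \<noteq> {}"
  shows "open_min I S \<noteq> {}"
  using ex_is_arg_min_if_finite[OF finite_open[OF assms(1)] assms(2)] by (auto simp: open_min_def)

text \<open>\<open>frontier\<close> turns minimality over OPEN into minimality over all reachable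
  unclosed states. Applied to \<open>v\<close> itself, this gives \<open>g \<le> dist v\<close>, so
  a selected state has optimal g.\<close>

lemma open_min_gval:
  assumes "search_inv S" "v \<in> open_min I S"
  shows "gopen S v = Some (real (dist v))"
    and "\<And>w g. gopen S w = Some g \<Longrightarrow> real (dist v) + heur I v \<le> g + heur I w"
    and "\<And>w. reach w \<Longrightarrow> w \<notin> dom (closed_list S) \<Longrightarrow> real (dist v) + heur I v \<le> real (dist w) + heur I w"
proof -
  obtain g where g: "gopen S v = Some g"
    and le: "\<And>w g'. gopen S w = Some g' \<Longrightarrow> g + heur I v \<le> g' + heur I w"
    using assms(2) by (auto simp: open_min_iff)
  note v = inv_open[OF assms(1) g]
  have *: "g + heur I v \<le> real (dist w) + heur I w" if w: "reach w" "w \<notin> dom (closed_list S)" for w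
  proof -
    obtain u where "gopen S u = Some (real (dist u))"
        "real (dist u) + heur I u \<le> real (dist w) + heur I w"
      using frontier[OF assms(1) w] .
    then show ?thesis
      using le[of u] by fastforce
  qed
  have "g = real (dist v)"
    using *[of v] v by (auto simp: domIff)
  then show "gopen S v = Some (real (dist v))"
    and "\<And>w g. gopen S w = Some g \<Longrightarrow> real (dist v) + heur I v \<le> g + heur I w"
    and "\<And>w. reach w \<Longrightarrow> w \<notin> dom (closed_list S) \<Longrightarrow> real (dist v) + heur I v \<le> real (dist w) + heur I w"
    using g le * by auto
qed

text \<open>A nearest goal has f equal to \<open>C\<close> and is never closed, so it bounds the
  minimum throughout the search.\<close>

lemma open_min_le_C:
  assumes "search_inv S" "v \<in> open_min I S"
  shows "real (dist v) + heur I v \<le> real C"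
proof -
  obtain t where t: "t \<in> goals I" "reach t" "dist t = C"
    using optimal_goal .
  then have "t \<notin> dom (closed_list S)"
    using inv_closed(2)[OF assms(1)] by blast
  then show ?thesis
    using open_min_gval(3)[OF assms t(2)] t heur_goal by simp
qed

text \<open>An unclosed state of \<open>S_less\<close> would push the minimal f below
  \<open>C\<close>.\<close>

lemma open_min_less:
  assumes "search_inv S" "v \<in> open_min I S" "real C \<le> real (dist v) + heur I v"
  shows "S_less I \<subseteq> dom (closed_list S)"
  using open_min_gval(3)[OF assms(1,2)] assms(3) by (force simp: S_less_iff)

end

section \<open>The run of a fixed strategy under a fixed random outcome\<close>

locale search_run = unit_cost_search I
  for I :: "'a search_instance" +
  fixes \<tau> :: "('r, 'a) rule" and \<omega> :: 'r
  assumes tie: "tie_breaker \<tau>"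
begin

definition st :: "nat \<Rightarrow> 'a search_state" where
  "st n = hd (history I \<tau> \<omega> n)"

definition choice :: "nat \<Rightarrow> 'a" where
  "choice n = \<tau> \<omega> I (history I \<tau> \<omega> n) (candidates I (st n))"

lemma st_Suc: "st (Suc n) = (if running I (st n) then expand I (choice n) (st n) else st n)"
  by (simp add: st_def choice_def Let_def)

lemma expanded_eq: "expanded I \<tau> \<omega> = {choice n |n. running I (st n)}"
  by (auto simp: expanded_def st_def choice_def)

text \<open>\<open>tie_breaker\<close> constrains a rule on finite nonempty sets. While the search
  runs, no goal is minimal, so the candidates are all of \<open>open_min\<close>, which is such a
  set.\<close>

lemma choice_candidate:
  assumes "search_inv (st n)" "running I (st n)"
  shows "choice n \<in> candidates I (st n)"
proof -
  have "candidates I (st n) = open_min I (st n)"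
    using assms(2) by (auto simp: candidates_def running_def)
  moreover have "open_min I (st n) \<noteq> {}"
    using open_min_ne assms by (simp add: running_def)
  moreover have "finite (open_min I (st n))"
    using finite_open[OF assms(1)] open_min_subset by (rule finite_subset[rotated])
  ultimately show ?thesis
    using tie by (simp add: tie_breaker_def choice_def)
qed

lemma inv_st: "search_inv (st n)"
proof (induction n)
  case 0
  then show ?case
    using search_inv_initial by (simp add: st_def)
next
  case (Suc n)
  show ?case
  proof (cases "running I (st n)")
    case True
    then have "choice n \<in> open_min I (st n)" "choice n \<notin> goals I"
      using choice_candidate[OF Suc] by (auto simp: candidates_def)
    then show ?thesis
      using search_inv_expand[OF Suc open_min_gval(1)[OF Suc]] True by (simp add: st_Suc)
  qed (simp add: st_Suc Suc)
qed

lemma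
  assumes "running I (st n)"
  shows choice_open_min: "choice n \<in> open_min I (st n)"
    and choice_nongoal: "choice n \<notin> goals I"
  using choice_candidate[OF inv_st assms] by (auto simp: candidates_def)

abbreviation closed :: "nat \<Rightarrow> 'a set" where
  "closed n \<equiv> dom (closed_list (st n))"

lemma closed_Suc:
  "closed (Suc n) = (if running I (st n) then insert (choice n) (closed n) else closed n)"
  using dom_closed_list_expand[OF inv_st open_min_gval(1)[OF inv_st choice_open_min]]
  by (simp add: st_Suc)

lemma choice_unclosed: "running I (st n) \<Longrightarrow> choice n \<notin> closed n"
  using inv_open(1)[OF inv_st open_min_gval(1)[OF inv_st choice_open_min]] by (simp add: domIff)

lemma choice_reach: "running I (st n) \<Longrightarrow> reach (choice n)"
  using inv_open(2)[OF inv_st open_min_gval(1)[OF inv_st choice_open_min]] .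

lemma closed_0: "closed 0 = {}"
  by (simp add: st_def initial_def)

lemma closed_mono: "m \<le> n \<Longrightarrow> closed m \<subseteq> closed n"
  by (induction rule: dec_induct) (auto simp: closed_Suc simp del: domIff)

lemma closed_subset_expanded: "closed n \<subseteq> expanded I \<tau> \<omega>"
  by (induction n) (auto simp: closed_0 closed_Suc expanded_eq simp del: domIff)

text \<open>Each running step closes a new vertex, and there are finitely many.\<close>

lemma stops: "\<exists>n. \<not> running I (st n)"
proof (rule ccontr)
  assume "\<not> ?thesis"
  then have run: "running I (st n)" for n
    by blast
  have closed_verts: "closed n \<subseteq> pverts (graph I)" for n
    using inv_closed(1)[OF inv_st] reach_verts by blast
  have card: "card (closed n) = n" for n
  proof (induction n)
    case (Suc n)
    have "finite (closed n)"
      using closed_verts pair_finite_verts by (rule finite_subset)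
    then show ?case
      using Suc run choice_unclosed by (simp add: closed_Suc del: domIff)
  qed (simp add: closed_0)
  show False
    using card_mono[OF pair_finite_verts closed_verts[of "Suc (card (pverts (graph I)))"]] card
    by simp
qed

text \<open>After stopping, the state repeats forever, so CLOSED at that point has collected every
  choice.\<close>

lemma final_state:
  obtains n where "\<not> running I (st n)" "closed n = expanded I \<tau> \<omega>"
proof -
  obtain n where n: "\<not> running I (st n)"
    using stops by blast
  have *: "st m = st n" if "n \<le> m" for m
    using that by (induction rule: dec_induct) (simp_all add: st_Suc n)
  have "closed m \<subseteq> closed n" for m
  proof (cases "m \<le> n")
    case False
    then show ?thesis
      using *[of m] by simp
  qed (rule closed_mono)
  moreover have "choice m \<in> closed (Suc m)" if "running I (st m)" for m
    using that by (simp add: closed_Suc del: domIff)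
  ultimately have "expanded I \<tau> \<omega> \<subseteq> closed n"
    unfolding expanded_eq by blast
  then show ?thesis
    using that n closed_subset_expanded by blast
qed

section \<open>Which states a run expands\<close>

lemma choice_layers:
  assumes "running I (st n)"
  shows "choice n \<in> S_less I \<union> S_eq I"
  using open_min_le_C[OF inv_st choice_open_min[OF assms]] choice_reach choice_nongoal assms
  by (auto simp: S_less_iff S_eq_iff)

lemma expanded_layers: "expanded I \<tau> \<omega> \<subseteq> S_less I \<union> S_eq I"
  using choice_layers by (auto simp: expanded_eq)

text \<open>A choice in \<open>S_eq\<close> shows that the minimal f is \<open>C\<close>, so an OPEN
  entry with f at most \<open>C\<close> is tied with it. As the search is running, the tied state is
  no goal.\<close>

lemma choice_S_eq:
  assumes "running I (st n)" "choice n \<in> S_eq I" "gopen (st n) w = Some g"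
    "g + heur I w \<le> real C"
  shows "w \<in> candidates I (st n)" "g + heur I w = real C"
proof -
  have *: "real C \<le> g' + heur I w'" if "gopen (st n) w' = Some g'" for w' g'
    using open_min_gval(2)[OF inv_st choice_open_min[OF assms(1)] that] assms(2)
    by (simp add: S_eq_iff)
  then have "w \<in> open_min I (st n)"
    using assms(3,4) by (auto simp: open_min_iff intro: order_trans)
  then show "w \<in> candidates I (st n)"
    using assms(1) by (auto simp: candidates_def running_def)
  show "g + heur I w = real C"
    using *[OF assms(3)] assms(4) by simp
qed

text \<open>If \<open>dist u + 1 \<le> C\<close>, the expansion of \<open>u\<close> has put
  \<open>t\<close> on OPEN with f at most \<open>C\<close>. Then \<open>t\<close> is minimal, and
  goal preference would have ended the search.\<close>

lemma choice_S_eq_goal: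
  assumes "running I (st n)" "choice n \<in> S_eq I" "u \<in> closed n" "(u, t) \<in> parcs (graph I)"
    "t \<in> goals I"
  shows "real C < real (dist u) + 1"
proof (rule ccontr)
  assume "\<not> ?thesis"
  moreover obtain g where g: "gopen (st n) t = Some g" "g \<le> real (dist u) + 1"
    using inv_succ[OF inv_st assms(3,4)] inv_closed(2)[OF inv_st] assms(5) by metis
  ultimately have "g + heur I t \<le> real C"
    using heur_goal assms(5) by simp
  then have "t \<in> candidates I (st n)"
    using choice_S_eq(1)[OF assms(1,2) g(1)] by blast
  then show False
    using assms(5) by (simp add: candidates_def)
qed

lemma stopped_goal:
  assumes "\<not> running I (st n)"
  obtains t where "t \<in> goals I" "gopen (st n) t = Some (real C)" "S_less I \<subseteq> closed n"
proof -
  obtain t where t: "t \<in> goals I" "reach t"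
    using optimal_goal by blast
  then have "t \<notin> closed n"
    using inv_closed(2)[OF inv_st] by blast
  then obtain u where "gopen (st n) u = Some (real (dist u))"
    using frontier[OF inv_st t(2)] by blast
  then have "dom (open_list (st n)) \<noteq> {}"
    by (auto simp: gopen_Some_iff)
  \<comment> \<open>With OPEN nonempty, the search can only have stopped because a goal is
    minimal.\<close>
  then obtain t where t: "t \<in> goals I" "t \<in> open_min I (st n)"
    using assms by (auto simp: running_def)
  note g = open_min_gval(1)[OF inv_st t(2)]
  have "dist t \<le> C"
    using open_min_le_C[OF inv_st t(2)] t(1) heur_goal by simp
  moreover have "C \<le> dist t"
    using C_le_dist[OF inv_open(2)[OF inv_st g] t(1)] .
  ultimately show ?thesis
    using that[OF t(1)] g open_min_less[OF inv_st t(2)] t(1) heur_goal by simp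
qed

lemma S_less_expanded: "S_less I \<subseteq> expanded I \<tau> \<omega>"
proof -
  obtain n where "\<not> running I (st n)" "closed n = expanded I \<tau> \<omega>"
    using final_state .
  then show ?thesis
    using stopped_goal by metis
qed

text \<open>Before any choice in \<open>S_eq\<close> all of \<open>S_less\<close> is closed,
  including a predecessor \<open>u\<close> of a goal with \<open>dist u + 1 \<le> C\<close>;
  \<open>choice_S_eq_goal\<close> forbids such a choice.\<close>

lemma expanded_nonpathological:
  assumes "nonpathological I"
  shows "expanded I \<tau> \<omega> = S_less I"
proof -
  obtain u t where u: "u \<in> S_less I" and t: "t \<in> goals I" "(u, t) \<in> parcs (graph I)"
    using assms nonpathological_iff by blast
  have "0 < heur I u"
    using u heur_pos reach_verts by (auto simp: S_less_iff)
  then have "real (dist u) < real C"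
    using u unfolding S_less_iff by linarith
  then have "real (dist u) + 1 \<le> real C"
    by simp
  have "choice n \<notin> S_eq I" if "running I (st n)" for n
  proof
    assume S_eq: "choice n \<in> S_eq I"
    then have "S_less I \<subseteq> closed n"
      using open_min_less[OF inv_st choice_open_min[OF that]] by (simp add: S_eq_iff)
    then show False
      using choice_S_eq_goal[OF that S_eq _ t(2,1)] u \<open>real (dist u) + 1 \<le> real C\<close> by fastforce
  qed
  then have "expanded I \<tau> \<omega> \<subseteq> S_less I"
    using choice_layers by (auto simp: expanded_eq)
  then show ?thesis
    using S_less_expanded by blast
qed

text \<open>The earlier expansion closes a state with a goal successor at distance at most
  \<open>C\<close>, after which \<open>choice_S_eq_goal\<close> leaves no room for the later
  one.\<close>

lemma expanded_B1_unique:
  assumes "running I (st m)" "choice m \<in> B1 I" "running I (st n)" "choice n \<in> B1 I"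
  shows "m = n"
proof -
  have False if lt: "m < n" and m: "running I (st m)" "choice m \<in> B1 I"
    and n: "running I (st n)" "choice n \<in> B1 I" for m n
  proof -
    obtain t where t: "t \<in> goals I" "(choice m, t) \<in> parcs (graph I)"
      "real (dist (choice m)) + 1 = real C"
      using B1_goal[OF m(2)] .
    have "choice m \<in> closed (Suc m)"
      using m(1) by (simp add: closed_Suc del: domIff)
    then have "choice m \<in> closed n"
      using closed_mono[of "Suc m" n] lt by (meson Suc_leI subsetD)
    then show False
      using choice_S_eq_goal[OF n(1) _ _ t(2,1)] n(2) t(3) by (simp add: B1_iff)
  qed
  then show ?thesis
    using assms by (metis linorder_neqE_nat)
qed

text \<open>The parent \<open>u\<close> of the goal found at the end has
  \<open>dist u + 1 = C\<close>. Pathology keeps \<open>u\<close> out of \<open>S_less\<close>, so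
  it lies in \<open>S_eq\<close>, where h(u) = \<open>C - dist u\<close> = 1.\<close>

lemma expanded_pathological:
  assumes "\<not> nonpathological I"
  obtains p where "p \<in> B1 I" "expanded I \<tau> \<omega> \<inter> B1 I = {p}"
proof -
  obtain n where n: "\<not> running I (st n)" "closed n = expanded I \<tau> \<omega>"
    using final_state .
  obtain t where t: "t \<in> goals I" "gopen (st n) t = Some (real C)"
    using stopped_goal[OF n(1)] by blast
  then obtain u where u: "u \<in> closed n" "(u, t) \<in> parcs (graph I)" "real C = real (dist u) + 1"
    using inv_open(4)[OF inv_st t(2)] start_nongoal by metis
  have "dist t = C"
    using inv_open(2,3)[OF inv_st t(2)] C_le_dist t(1) by fastforce
  then have "u \<notin> S_less I"
    using assms u(2) t(1) nonpathological_iff by blast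
  then have "u \<in> S_eq I"
    using u(1) n(2) expanded_layers by blast
  then have "u \<in> B1 I"
    using u(3) by (simp add: B1_iff S_eq_iff)
  moreover have "v = u" if "v \<in> expanded I \<tau> \<omega> \<inter> B1 I" for v
  proof -
    have "u \<in> expanded I \<tau> \<omega>"
      using u(1) n(2) by blast
    then show ?thesis
      using that \<open>u \<in> B1 I\<close> expanded_B1_unique by (auto simp: expanded_eq)
  qed
  ultimately show ?thesis
    using that[of u] u(1) n(2) by blast
qed

text \<open>Consider the moment at which \<open>p\<close> is chosen: every candidate then has h at
  most 1. An unclosed state of \<open>S_eq - B1\<close> would give, through \<open>frontier\<close>,
  a candidate with h at least 2.\<close>

lemma expanded_highest:
  assumes path: "\<not> nonpathological I"
    and highest: "\<And>H C w. finite C \<Longrightarrow> w \<in> C \<Longrightarrow> heur I w \<le> heur I (\<tau> \<omega> I H C)"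
  shows "\<exists>p\<in>B1 I. expanded I \<tau> \<omega> = S_less I \<union> (S_eq I - B1 I) \<union> {p}"
proof -
  obtain p where p: "p \<in> B1 I" "expanded I \<tau> \<omega> \<inter> B1 I = {p}"
    using expanded_pathological[OF path] .
  then have "p \<in> expanded I \<tau> \<omega>"
    by blast
  then obtain n where n: "running I (st n)" "p = choice n"
    by (auto simp: expanded_eq)
  then have S_eq: "choice n \<in> S_eq I" "heur I (choice n) = 1"
    using p(1) by (auto simp: B1_iff)
  have "finite (candidates I (st n))"
    using finite_open[OF inv_st] open_min_subset unfolding candidates_def
    by (meson finite_Diff finite_subset)
  then have high: "heur I w \<le> heur I (choice n)" if "w \<in> candidates I (st n)" for w
    using highest that unfolding choice_def by blast
  have "v \<in> closed n" if v: "v \<in> S_eq I - B1 I" for v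
  proof (rule ccontr)
    assume "v \<notin> closed n"
    moreover have "reach v" "real (dist v) + heur I v = real C"
      using v by (auto simp: S_eq_iff)
    ultimately obtain u where u: "gopen (st n) u = Some (real (dist u))" "dist u \<le> dist v"
      "real (dist u) + heur I u \<le> real C"
      using frontier[OF inv_st] by metis
    note f = choice_S_eq[OF n(1) S_eq(1) u(1,3)]
    \<comment> \<open>Both states have f equal to \<open>C\<close>, so the one of smaller distance
      has the larger h.\<close>
    have "heur I v \<le> heur I u"
      using f(2) u(2) \<open>real (dist v) + heur I v = real C\<close> by simp
    then show False
      using S_eq_heur[OF v] high[OF f(1)] S_eq(2) by simp
  qed
  then have "S_eq I - B1 I \<subseteq> expanded I \<tau> \<omega>"
    using closed_subset_expanded by blast
  then have "expanded I \<tau> \<omega> = S_less I \<union> (S_eq I - B1 I) \<union> {p}"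
    using expanded_layers S_less_expanded p by blast
  then show ?thesis
    using p(1) by blast
qed

end

section \<open>High-h strategies and the comparison with arbitrary ones\<close>

lemma high_h_ge:
  assumes "tie_breaker \<sigma>" "finite C" "w \<in> C"
  shows "heur I w \<le> heur I (high_h \<sigma> \<omega> I H C)"
proof -
  let ?M = "{v. is_arg_max (heur I) (\<lambda>w. w \<in> C) v}"
  have "Max (heur I ` C) \<in> heur I ` C"
    using assms(2,3) by (intro Max_in) auto
  then obtain v where "v \<in> C" "heur I v = Max (heur I ` C)"
    by auto
  then have "v \<in> ?M"
    using assms(2) by (auto simp: is_arg_max_def not_less)
  moreover have "finite ?M"
    using assms(2) by (rule finite_subset[rotated]) (auto simp: is_arg_max_def)
  ultimately have "high_h \<sigma> \<omega> I H C \<in> ?M"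
    using assms(1) unfolding tie_breaker_def high_h_def by blast
  then show ?thesis
    using assms(3) by (auto simp: is_arg_max_def not_less)
qed

context unit_cost_search
begin

text \<open>Comparing strategies involves two runs, possibly with different types of outcomes, so
  results on single runs are restated with rule and outcome free.\<close>

lemma search_runI: "tie_breaker \<tau> \<Longrightarrow> search_run I \<tau>"
  by (simp add: search_run_def search_run_axioms_def unit_cost_search_axioms)

lemmas expanded_nonpathological = search_run.expanded_nonpathological[OF search_runI]
  and expanded_pathological = search_run.expanded_pathological[OF search_runI]
  and expanded_layers = search_run.expanded_layers[OF search_runI]

lemma expanded_high_h:
  assumes "tie_breaker \<sigma>" "\<not> nonpathological I"
  shows "\<exists>p\<in>B1 I. expanded I (high_h \<sigma>) \<omega> = S_less I \<union> (S_eq I - B1 I) \<union> {p}"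
  using search_run.expanded_highest[OF search_runI[OF tie_breaker_high_h[OF assms(1)]] assms(2)]
    high_h_ge[OF assms(1)] by blast

lemma finite_layers: "finite (S_less I)" "finite (S_eq I)"
proof -
  have "S_less I \<union> S_eq I \<subseteq> pverts (graph I)"
    using reach_verts by (auto simp: S_less_iff S_eq_iff)
  then show "finite (S_less I)" "finite (S_eq I)"
    using pair_finite_verts finite_subset by blast+
qed

lemma S_less_S_eq_disjoint: "S_less I \<inter> S_eq I = {}"
  by (auto simp: S_less_iff S_eq_iff)

lemma S_less_B1_disjoint: "S_less I \<inter> B1 I = {}"
  using S_less_S_eq_disjoint by (auto simp: B1_iff)

lemma expansion_count_high_h:
  assumes "tie_breaker \<sigma>"
  shows "expansion_count I (high_h \<sigma>) \<omega> =
    (if nonpathological I then card (S_less I) else card (S_less I) + card (S_eq I - B1 I) + 1)"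
proof (cases "nonpathological I")
  case True
  then show ?thesis
    using expanded_nonpathological[OF tie_breaker_high_h[OF assms] True] by (simp add: expansion_count_def)
next
  case False
  then obtain p where p: "p \<in> B1 I" "expanded I (high_h \<sigma>) \<omega> = S_less I \<union> (S_eq I - B1 I) \<union> {p}"
    using expanded_high_h[OF assms] by blast
  have "p \<notin> S_less I \<union> (S_eq I - B1 I)"
    using p(1) S_less_S_eq_disjoint by (auto simp: B1_iff)
  moreover have "card (S_less I \<union> (S_eq I - B1 I)) = card (S_less I) + card (S_eq I - B1 I)"
    using finite_layers S_less_S_eq_disjoint by (intro card_Un_disjoint) auto
  ultimately show ?thesis
    using False p(2) finite_layers by (simp add: expansion_count_def)
qed

text \<open>In the pathological case each run meets \<open>B1\<close> in one state, not necessarily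
  the same, and outside \<open>B1\<close> the high-h run already expands everything that
  \<open>expanded_layers\<close> allows.\<close>

lemma expanded_compare:
  fixes \<sigma> :: "('r, 'a) rule" and \<tau> :: "('q, 'a) rule"
  assumes \<sigma>: "tie_breaker \<sigma>" and \<tau>: "tie_breaker \<tau>"
  shows "expanded I \<tau> \<omega>' - B1 I \<subseteq> expanded I (high_h \<sigma>) \<omega>"
    and "card (expanded I \<tau> \<omega>' \<inter> B1 I) = card (expanded I (high_h \<sigma>) \<omega> \<inter> B1 I)"
    and "card (expanded I (high_h \<sigma>) \<omega> \<inter> B1 I) \<in> {0, 1}"
proof -
  note high = tie_breaker_high_h[OF \<sigma>]
  have "expanded I \<tau> \<omega>' - B1 I \<subseteq> expanded I (high_h \<sigma>) \<omega> \<and>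
    card (expanded I \<tau> \<omega>' \<inter> B1 I) = card (expanded I (high_h \<sigma>) \<omega> \<inter> B1 I) \<and>
    card (expanded I (high_h \<sigma>) \<omega> \<inter> B1 I) \<in> {0, 1}"
  proof (cases "nonpathological I")
    case True
    then show ?thesis
      using S_less_B1_disjoint
      by (simp add: expanded_nonpathological[OF high] expanded_nonpathological[OF \<tau>])
  next
    case False
    obtain p where "expanded I \<tau> \<omega>' \<inter> B1 I = {p}"
      using expanded_pathological[OF \<tau> False] .
    moreover obtain q where "expanded I (high_h \<sigma>) \<omega> \<inter> B1 I = {q}"
      using expanded_pathological[OF high False] .
    moreover have "expanded I \<tau> \<omega>' - B1 I \<subseteq> expanded I (high_h \<sigma>) \<omega>"
      using expanded_high_h[OF \<sigma> False] expanded_layers[OF \<tau>] by blast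
    ultimately show ?thesis
      by simp
  qed
  then show "expanded I \<tau> \<omega>' - B1 I \<subseteq> expanded I (high_h \<sigma>) \<omega>"
    and "card (expanded I \<tau> \<omega>' \<inter> B1 I) = card (expanded I (high_h \<sigma>) \<omega> \<inter> B1 I)"
    and "card (expanded I (high_h \<sigma>) \<omega> \<inter> B1 I) \<in> {0, 1}"
    by blast+
qed

lemma finite_expanded: "tie_breaker \<tau> \<Longrightarrow> finite (expanded I \<tau> \<omega>)"
  using expanded_layers finite_layers by (meson finite_UnI finite_subset)

text \<open>Split both expanded sets along \<open>B1\<close>: the parts inside have equal size, and
  outside there is an inclusion.\<close>

lemma expansion_count_le_high_h:
  fixes \<sigma> :: "('r, 'a) rule" and \<tau> :: "('q, 'a) rule"
  assumes \<sigma>: "tie_breaker \<sigma>" and \<tau>: "tie_breaker \<tau>"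
  shows "expansion_count I \<tau> \<omega>' \<le> expansion_count I (high_h \<sigma>) \<omega>"
proof -
  have fin: "finite (expanded I \<tau> \<omega>')" "finite (expanded I (high_h \<sigma>) \<omega>)"
    using finite_expanded[OF \<tau>] finite_expanded[OF tie_breaker_high_h[OF \<sigma>]] by blast+
  note cmp = expanded_compare(1,2)[OF \<sigma> \<tau>, where \<omega> = \<omega> and \<omega>' = \<omega>']
  have split: "card A = card (A \<inter> B1 I) + card (A - B1 I)" if "finite A" for A
    using card_Int_Diff[OF that] .
  have "card (expanded I \<tau> \<omega>' - B1 I) \<le> card (expanded I (high_h \<sigma>) \<omega> - B1 I)"
    using cmp(1) fin(2) by (intro card_mono) auto
  then show ?thesis
    using split[OF fin(1)] split[OF fin(2)] cmp(2) by (simp add: expansion_count_def)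
qed

end

theorem theorem3:
  fixes I :: "'a search_instance"
  assumes "search_instance I"
    and "solvable I"
    and "\<forall>e\<in>parcs (graph I). cost I e = 1"
    and "consistent I"
    and "\<forall>v\<in>goals I. heur I v = 0"
    and "\<forall>v\<in>pverts (graph I) - goals I. 0 < heur I v"
    and "\<forall>v\<in>B1 I. ereal (heur I v) = hstar I v"
  shows
    "(nonpathological I \<longrightarrow>
        (\<forall>(\<tau> :: ('q, 'a) rule) \<omega>. tie_breaker \<tau> \<longrightarrow> expanded I \<tau> \<omega> = S_less I)) \<and>
     (\<not> nonpathological I \<longrightarrow>
        (\<forall>(\<sigma> :: ('r, 'a) rule) \<omega>. tie_breaker \<sigma> \<longrightarrow>
           (\<exists>p\<in>B1 I. expanded I (high_h \<sigma>) \<omega> = S_less I \<union> (S_eq I - B1 I) \<union> {p}))) \<and>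
     (\<forall>(\<sigma> :: ('r, 'a) rule) \<omega>. tie_breaker \<sigma> \<longrightarrow>
        expansion_count I (high_h \<sigma>) \<omega> =
          (if nonpathological I then card (S_less I)
           else card (S_less I) + card (S_eq I - B1 I) + 1)) \<and>
     (\<forall>(\<sigma> :: ('r, 'a) rule) \<omega> (\<tau> :: ('q, 'a) rule) \<omega>'. tie_breaker \<sigma> \<longrightarrow> tie_breaker \<tau> \<longrightarrow>
        expansion_count I \<tau> \<omega>' \<le> expansion_count I (high_h \<sigma>) \<omega>) \<and>
     (\<forall>(\<sigma> :: ('r, 'a) rule) \<omega> (\<tau> :: ('q, 'a) rule) \<omega>'. tie_breaker \<sigma> \<longrightarrow> tie_breaker \<tau> \<longrightarrow>
        expanded I \<tau> \<omega>' - B1 I \<subseteq> expanded I (high_h \<sigma>) \<omega> \<and>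
        card (expanded I \<tau> \<omega>' \<inter> B1 I) = card (expanded I (high_h \<sigma>) \<omega> \<inter> B1 I) \<and>
        card (expanded I (high_h \<sigma>) \<omega> \<inter> B1 I) \<in> {0, 1})"
proof -
  interpret unit_cost_search I
    using assms by unfold_locales
  show ?thesis
    by (intro conjI allI impI expanded_nonpathological expanded_high_h expansion_count_high_h
        expansion_count_le_high_h expanded_compare) assumption+
qed

end
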